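(* For any $n \in \mathbb{N}$, any $j \in \mathbb{Z} \cap (-n,+\infty)$ and any $p \in [0,1]$ we have $$\mathbb{E}_{n,p}\left[\, g_{n,p}(j,|\mathcal{C}|)\,\right]=\frac{n+j}{n}\left(1-\mathbb{P}_{n+j,p}\left[\,|\mathcal{C}|>n\,\right]\right),$$ where for $k\in\{1,\dots,n\}$ $$g_{n,p}(j,k)=(1-p)^{jk}\prod_{i=0}^{k-1}\frac{n-i+j}{n-i}.$$
   Context: $\mathbb{N}=\{1,2,3,\dots\}$. For $m\in\mathbb{N}$ and $p\in[0,1]$, $\mathcal{G}_{m,p}$ is the Erdős–Rényi random graph on the vertex set $\{1,\dots,m\}$ in which each pair of vertices is connected by an edge with probability $p$, independently of all other pairs. $\mathbb{P}_{m,p}$ is its law and $\mathbb{E}_{m,p}$ the corresponding expectation. Under $\mathbb{P}_{m,p}$, $\mathcal{C}$ is the connected component in $\mathcal{G}_{m,p}$ of the vertex indexed by $1$, and $|\mathcal{C}|$ is its number of vertices.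
   Formalization: The case p = 1 with j < 0 is excluded: there g_{n,p}(j,|C|) contains a negative power of 0 times a vanishing product and is undefined, and reading it as 0 would make the identity false. *)

theory Defs
  imports "HOL-Probability.Probability"
begin

definition vertex_pairs :: "nat \<Rightarrow> nat set set" where
  "vertex_pairs m = {e. e \<subseteq> {1..m} \<and> card e = 2}"

text \<open>A graph on the vertex set \<open>{1..m}\<close> is represented by its set of edges, a subset of
  \<^term>\<open>vertex_pairs m\<close>.\<close>

definition erdos_renyi :: "nat \<Rightarrow> real \<Rightarrow> nat set set pmf" where
  "erdos_renyi m p =
     map_pmf (\<lambda>\<omega>. {e \<in> vertex_pairs m. \<omega> e})
       (Pi_pmf (vertex_pairs m) False (\<lambda>_. bernoulli_pmf p))"

text \<open>The reflexive closure puts \<open>v\<close> itself into its component; all other members are endpoints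
  of edges, so for \<open>v\<close> in the vertex set there is no need to intersect with the vertex set.\<close>

definition component_of :: "'a set set \<Rightarrow> 'a \<Rightarrow> 'a set" where
  "component_of E v = {w. (v, w) \<in> {(x, y). {x, y} \<in> E}\<^sup>*}"

text \<open>The exponent \<open>j * k\<close> may be negative, hence the integer power. For \<open>p = 1\<close> and \<open>j < 0\<close> the
  expression contains a negative power of zero and is mathematically undefined (HOL totalizes it
  to 0); for \<open>p = 1\<close> and \<open>j = 0\<close> the convention is that the zeroth power of 0 is 1.\<close>

definition g :: "nat \<Rightarrow> real \<Rightarrow> int \<Rightarrow> nat \<Rightarrow> real" where
  "g n p j k = (1 - p) powi (j * int k) *
     (\<Prod>i<k. (real n - real i + real_of_int j) / (real n - real i))"

end

theory Submission
  imports Defs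
begin

text \<open>A set \<open>S\<close> of \<open>k\<close> vertices is the component of \<open>1\<close> iff the graph induced on \<open>S\<close> is connected
  and none of the \<open>k (m - k)\<close> edges between \<open>S\<close> and its complement is present. Hence the component
  has size \<open>k\<close> with probability \<open>binomial (m - 1) (k - 1) * c k * (1 - p) ^ (k (m - k))\<close>, where
  \<open>c k\<close> does not depend on \<open>m\<close>. The ratio of these probabilities for \<open>m = n + j\<close> and for \<open>n\<close> is
  \<open>n / (n + j) * g n p j k\<close>, and it remains to sum over \<open>k \<le> n\<close>.\<close>

definition edges_on :: "'a set \<Rightarrow> 'a set set" where
  "edges_on S = {e. e \<subseteq> S \<and> card e = 2}"

definition edge_weight :: "real \<Rightarrow> 'e set \<Rightarrow> 'e set \<Rightarrow> real" where
  "edge_weight p D E = p ^ card E * (1 - p) ^ card (D - E)"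

lemma vertex_pairs_eq: "vertex_pairs m = edges_on {1..m}"
  by (simp add: vertex_pairs_def edges_on_def)

lemma finite_edges_on: "finite S \<Longrightarrow> finite (edges_on S)"
  unfolding edges_on_def by simp

lemma edges_on_mono: "S \<subseteq> T \<Longrightarrow> edges_on S \<subseteq> edges_on T"
  by (auto simp: edges_on_def)

lemma doubleton_in_edges_on_iff: "{x, y} \<in> edges_on S \<longleftrightarrow> x \<in> S \<and> y \<in> S \<and> x \<noteq> y"
  by (cases "x = y") (auto simp: edges_on_def)

lemma edges_onE:
  assumes "e \<in> edges_on S"
  obtains x y where "e = {x, y}" "x \<in> S" "y \<in> S" "x \<noteq> y"
  using assms by (auto simp: edges_on_def card_2_iff)

subsection \<open>Edge weights and the law of the random graph\<close>

lemma sum_edge_weight_Pow: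
  assumes "finite D"
  shows "(\<Sum>E\<in>Pow D. edge_weight p D E) = 1"
  using prod_add[OF assms, of "\<lambda>_. p" "\<lambda>_. 1 - p"] by (simp add: edge_weight_def)

lemma edge_weight_Un:
  assumes "finite D1" "finite D2" "D1 \<inter> D2 = {}" "A \<subseteq> D1" "B \<subseteq> D2"
  shows "edge_weight p (D1 \<union> D2) (A \<union> B) = edge_weight p D1 A * edge_weight p D2 B"
proof -
  have "card (A \<union> B) = card A + card B"
    using assms by (intro card_Un_disjoint) (auto intro: finite_subset)
  moreover have "D1 \<union> D2 - (A \<union> B) = (D1 - A) \<union> (D2 - B)"
    using assms by auto
  moreover have "card ((D1 - A) \<union> (D2 - B)) = card (D1 - A) + card (D2 - B)"
    using assms by (intro card_Un_disjoint) auto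
  ultimately show ?thesis
    by (simp add: edge_weight_def power_add)
qed

lemma sum_edge_weight_Un:
  assumes "finite D1" "finite D2" "D1 \<inter> D2 = {}"
  shows "(\<Sum>E\<in>Pow (D1 \<union> D2). edge_weight p (D1 \<union> D2) E * (f (E \<inter> D1) * h (E \<inter> D2))) =
    (\<Sum>A\<in>Pow D1. edge_weight p D1 A * f A) * (\<Sum>B\<in>Pow D2. edge_weight p D2 B * h B)"
proof -
  have inter: "(A \<union> B) \<inter> D1 = A" "(A \<union> B) \<inter> D2 = B" if "A \<subseteq> D1" "B \<subseteq> D2" for A B
    using that assms(3) by auto
  have "(\<Sum>E\<in>Pow (D1 \<union> D2). edge_weight p (D1 \<union> D2) E * (f (E \<inter> D1) * h (E \<inter> D2))) =
      (\<Sum>(A, B)\<in>Pow D1 \<times> Pow D2. (edge_weight p D1 A * f A) * (edge_weight p D2 B * h B))"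
    by (rule sum.reindex_bij_witness[where i = "\<lambda>(A, B). A \<union> B" and j = "\<lambda>E. (E \<inter> D1, E \<inter> D2)"])
      (use assms(3) in \<open>auto simp: inter simp flip: edge_weight_Un[OF assms] Int_Un_distrib
         intro!: arg_cong[of _ _ "edge_weight _ _"]\<close>)
  then show ?thesis
    by (simp add: sum_product sum.cartesian_product)
qed

lemma set_pmf_erdos_renyi: "set_pmf (erdos_renyi m p) \<subseteq> Pow (vertex_pairs m)"
  by (auto simp: erdos_renyi_def)

lemma finite_vertex_pairs: "finite (vertex_pairs m)"
  by (simp add: vertex_pairs_eq finite_edges_on)

lemma pmf_erdos_renyi:
  assumes "0 \<le> p" "p \<le> 1" "E \<subseteq> vertex_pairs m"
  shows "pmf (erdos_renyi m p) E = edge_weight p (vertex_pairs m) E"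
proof -
  let ?V = "vertex_pairs m"
  let ?M = "Pi_pmf ?V False (\<lambda>_. bernoulli_pmf p)"
  have "pmf (erdos_renyi m p) E = measure_pmf.prob ?M ((\<lambda>\<omega>. {e \<in> ?V. \<omega> e}) -` {E})"
    by (simp add: erdos_renyi_def pmf_map)
  also have "\<dots> = measure_pmf.prob ?M {\<lambda>e. e \<in> E}"
    using set_Pi_pmf_subset[OF finite_vertex_pairs, of m False "\<lambda>_. bernoulli_pmf p"] assms(3)
    by (intro measure_pmf.finite_measure_eq_AE) (fastforce simp: AE_measure_pmf_iff fun_eq_iff)+
  also have "\<dots> = (\<Prod>e\<in>?V. pmf (bernoulli_pmf p) (e \<in> E))"
    using assms(3) by (subst measure_pmf_single, subst pmf_Pi') (auto simp: finite_vertex_pairs)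
  also have "\<dots> = (\<Prod>e\<in>?V. if e \<in> E then p else 1 - p)"
    using assms by (intro prod.cong) auto
  also have "\<dots> = edge_weight p ?V E"
    using assms(3)
    by (simp add: prod.If_cases finite_vertex_pairs edge_weight_def Int_absorb1 Diff_eq)
  finally show ?thesis .
qed

lemma expectation_erdos_renyi:
  fixes f :: "nat set set \<Rightarrow> real"
  assumes "0 \<le> p" "p \<le> 1"
  shows "measure_pmf.expectation (erdos_renyi m p) f =
    (\<Sum>E\<in>Pow (vertex_pairs m). edge_weight p (vertex_pairs m) E * f E)"
  using set_pmf_erdos_renyi[of m p] assms
  by (subst integral_measure_pmf_real[where A = "Pow (vertex_pairs m)"])
    (auto simp: finite_vertex_pairs pmf_erdos_renyi mult.commute intro!: sum.cong)

subsection \<open>The component of a vertex\<close>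

lemma component_of_self: "v \<in> component_of E v"
  by (simp add: component_of_def)

lemma component_of_step: "x \<in> component_of E v \<Longrightarrow> {x, y} \<in> E \<Longrightarrow> y \<in> component_of E v"
  by (auto simp: component_of_def intro: rtrancl_into_rtrancl)

lemma component_of_induct [consumes 1, case_names self step]:
  assumes "w \<in> component_of E v" "P v"
    and "\<And>x y. x \<in> component_of E v \<Longrightarrow> {x, y} \<in> E \<Longrightarrow> P x \<Longrightarrow> P y"
  shows "P w"
proof -
  have "(v, w) \<in> {(x, y). {x, y} \<in> E}\<^sup>*"
    using assms(1) by (simp add: component_of_def)
  then show ?thesis
    by (induction rule: rtrancl_induct) (use assms in \<open>auto simp: component_of_def\<close>)
qed

lemma component_of_subset:
  assumes "v \<in> S" "\<And>x y. x \<in> S \<Longrightarrow> {x, y} \<in> E \<Longrightarrow> y \<in> S"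
  shows "component_of E v \<subseteq> S"
proof
  fix w assume "w \<in> component_of E v"
  then show "w \<in> S"
    by (induction rule: component_of_induct) (use assms in auto)
qed

lemma component_of_subset_vertices:
  assumes "E \<subseteq> edges_on V" "v \<in> V"
  shows "component_of E v \<subseteq> V"
  using assms by (intro component_of_subset) (auto simp: edges_on_def)

lemma component_of_mono: "E \<subseteq> F \<Longrightarrow> component_of E v \<subseteq> component_of F v"
  by (rule component_of_subset) (auto intro: component_of_self component_of_step)

definition boundary_edges :: "'a set \<Rightarrow> 'a set \<Rightarrow> 'a set set" where
  "boundary_edges V S = edges_on V - edges_on S - edges_on (V - S)"

lemma component_of_eq_iff:
  assumes "E \<subseteq> edges_on V" "v \<in> S" "S \<subseteq> V"
  shows "component_of E v = S \<longleftrightarrow>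
    component_of (E \<inter> edges_on S) v = S \<and> E \<inter> boundary_edges V S = {}"
proof (intro iffI conjI)
  assume S: "component_of E v = S"
  have closed: "y \<in> S" if "x \<in> S" "{x, y} \<in> E" for x y
    using that component_of_step[of x E v y] S by simp
  have "w \<in> component_of (E \<inter> edges_on S) v" if "w \<in> component_of E v" for w
    using that
  proof (induction rule: component_of_induct)
    case self
    show ?case by (rule component_of_self)
  next
    case (step x y)
    have "{x, y} \<in> edges_on V"
      using step.hyps(2) assms(1) by auto
    then have "x \<noteq> y"
      by (simp add: doubleton_in_edges_on_iff)
    then have "{x, y} \<in> edges_on S"
      using step.hyps S closed by (auto simp: doubleton_in_edges_on_iff)
    then show ?case
      using step by (auto intro: component_of_step)
  qed
  then show "component_of (E \<inter> edges_on S) v = S"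
    using S component_of_mono[of "E \<inter> edges_on S" E v] by auto
  have False if "e \<in> E" "e \<in> boundary_edges V S" for e
  proof -
    from that(2) obtain x y where "e = {x, y}" "x \<in> V" "y \<in> V" "x \<noteq> y"
      by (auto simp: boundary_edges_def elim: edges_onE)
    with that closed[of x y] closed[of y x] show ?thesis
      by (auto simp: boundary_edges_def doubleton_in_edges_on_iff insert_commute)
  qed
  then show "E \<inter> boundary_edges V S = {}" by auto
next
  assume *: "component_of (E \<inter> edges_on S) v = S \<and> E \<inter> boundary_edges V S = {}"
  have "component_of E v \<subseteq> S"
  proof (rule component_of_subset)
    fix x y assume "x \<in> S" "{x, y} \<in> E"
    moreover have "{x, y} \<in> edges_on V" "{x, y} \<notin> boundary_edges V S"
      using \<open>{x, y} \<in> E\<close> assms(1) * by auto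
    ultimately show "y \<in> S"
      by (auto simp: boundary_edges_def doubleton_in_edges_on_iff)
  qed (use assms in auto)
  then show "component_of E v = S"
    using * component_of_mono[of "E \<inter> edges_on S" E v] by auto
qed

lemma card_boundary_edges:
  assumes "finite V" "S \<subseteq> V"
  shows "card (boundary_edges V S) = card S * (card V - card S)"
proof -
  have "boundary_edges V S = (\<lambda>(x, y). {x, y}) ` (S \<times> (V - S))"
  proof safe
    fix e assume e: "e \<in> boundary_edges V S"
    then obtain x y where "e = {x, y}" "x \<in> V" "y \<in> V" "x \<noteq> y"
      by (auto simp: boundary_edges_def elim: edges_onE)
    with e have "e = {x, y} \<and> (x, y) \<in> S \<times> (V - S) \<or> e = {y, x} \<and> (y, x) \<in> S \<times> (V - S)"
      by (auto simp: boundary_edges_def doubleton_in_edges_on_iff)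
    then show "e \<in> (\<lambda>(x, y). {x, y}) ` (S \<times> (V - S))"
      by force
  qed (use assms in \<open>auto simp: boundary_edges_def doubleton_in_edges_on_iff\<close>)
  moreover have "inj_on (\<lambda>(x, y). {x, y}) (S \<times> (V - S))"
    by (auto simp: inj_on_def doubleton_eq_iff)
  ultimately have "card (boundary_edges V S) = card (S \<times> (V - S))"
    by (simp add: card_image)
  also have "\<dots> = card S * (card V - card S)"
    using assms by (simp add: card_cartesian_product card_Diff_subset finite_subset)
  finally show ?thesis .
qed

subsection \<open>Spanning components\<close>

definition connected_weight :: "real \<Rightarrow> 'a set \<Rightarrow> 'a \<Rightarrow> real" where
  "connected_weight p S v =
     (\<Sum>E\<in>Pow (edges_on S). edge_weight p (edges_on S) E * of_bool (component_of E v = S))"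

lemma component_of_image:
  assumes "inj_on f S" "E \<subseteq> edges_on S" "v \<in> S"
  shows "component_of ((`) f ` E) (f v) = f ` component_of E v"
proof
  note sub = component_of_subset_vertices[OF assms(2,3)]
  show "component_of ((`) f ` E) (f v) \<subseteq> f ` component_of E v"
  proof (rule component_of_subset)
    fix x y assume "x \<in> f ` component_of E v" and "{x, y} \<in> (`) f ` E"
    then obtain u e where u: "x = f u" "u \<in> component_of E v" and e: "e \<in> E" "{x, y} = f ` e"
      by auto
    obtain a b where ab: "e = {a, b}" "a \<in> S" "b \<in> S"
      using subsetD[OF assms(2) e(1)] by (rule edges_onE)
    have "u \<in> S" using u(2) sub by auto
    from e(2) have "f u = f a \<and> y = f b \<or> f u = f b \<and> y = f a"
      by (auto simp: ab u doubleton_eq_iff)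
    then have "u = a \<and> y = f b \<or> u = b \<and> y = f a"
      using assms(1) ab \<open>u \<in> S\<close> by (auto simp: inj_on_eq_iff)
    then obtain c where "e = {u, c}" "y = f c"
      using ab by auto
    then show "y \<in> f ` component_of E v"
      using e(1) u(2) by (auto intro: component_of_step)
  qed (auto intro: component_of_self)
  show "f ` component_of E v \<subseteq> component_of ((`) f ` E) (f v)"
  proof safe
    fix w assume "w \<in> component_of E v"
    then show "f w \<in> component_of ((`) f ` E) (f v)"
    proof (induction rule: component_of_induct)
      case (step x y)
      have "{f x, f y} \<in> (`) f ` E"
        using step.hyps(2) by (force intro: rev_image_eqI)
      with step.IH show ?case by (rule component_of_step)
    qed (rule component_of_self)
  qed
qed

lemma image_edges_on:
  assumes "bij_betw f S T"
  shows "bij_betw ((`) f) (edges_on S) (edges_on T)"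
proof -
  have inj: "inj_on ((`) f) (Pow S)"
    using assms by (simp add: bij_betw_def inj_on_image_Pow)
  have "edges_on S \<subseteq> Pow S"
    by (auto simp: edges_on_def)
  then have "inj_on ((`) f) (edges_on S)"
    using inj by (rule inj_on_subset[rotated])
  moreover have "(`) f ` edges_on S = edges_on T"
  proof safe
    fix e assume "e \<in> edges_on S"
    then obtain x y where "e = {x, y}" "x \<in> S" "y \<in> S" "x \<noteq> y" by (rule edges_onE)
    then show "f ` e \<in> edges_on T"
      using assms by (auto simp: doubleton_in_edges_on_iff bij_betw_def inj_on_eq_iff)
  next
    fix e assume "e \<in> edges_on T"
    then obtain x y where e: "e = {x, y}" "x \<in> T" "y \<in> T" "x \<noteq> y" by (rule edges_onE)
    then obtain a b where "x = f a" "y = f b" "a \<in> S" "b \<in> S"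
      using assms by (auto simp: bij_betw_def)
    with e show "e \<in> (`) f ` edges_on S"
      by (intro image_eqI[of _ _ "{a, b}"]) (auto simp: doubleton_in_edges_on_iff)
  qed
  ultimately show ?thesis by (simp add: bij_betw_def)
qed

lemma connected_weight_bij:
  assumes "bij_betw f S T" "v \<in> S"
  shows "connected_weight p S v = connected_weight p T (f v)"
proof -
  let ?F = "(`) ((`) f)"
  have bij: "bij_betw ((`) f) (edges_on S) (edges_on T)"
    by (rule image_edges_on[OF assms(1)])
  then have inj: "inj_on ((`) f) (edges_on S)" by (simp add: bij_betw_def)
  have weight: "edge_weight p (edges_on T) (?F E) = edge_weight p (edges_on S) E"
    if "E \<subseteq> edges_on S" for E
  proof -
    have "edges_on T - ?F E = ?F (edges_on S - E)"
      using bij inj_on_image_set_diff[OF inj _ that, of "edges_on S"] by (simp add: bij_betw_def)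
    moreover have "card (?F (edges_on S - E)) = card (edges_on S - E)" "card (?F E) = card E"
      using that by (auto intro!: card_image inj_on_subset[OF inj])
    ultimately show ?thesis by (simp add: edge_weight_def)
  qed
  have comp: "component_of (?F E) (f v) = T \<longleftrightarrow> component_of E v = S" if "E \<subseteq> edges_on S" for E
  proof -
    have "component_of (?F E) (f v) = f ` component_of E v"
      using component_of_image[OF _ that assms(2), of f] assms(1) by (simp add: bij_betw_def)
    moreover have "T = f ` S" "inj_on f S"
      using assms(1) by (auto simp: bij_betw_def)
    ultimately show ?thesis
      using component_of_subset_vertices[OF that assms(2)] by (simp add: inj_on_image_eq_iff)
  qed
  have "bij_betw ?F (Pow (edges_on S)) (Pow (edges_on T))"
    using bij by (rule bij_betw_Pow)
  then have "connected_weight p T (f v) = (\<Sum>E\<in>Pow (edges_on S).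
      edge_weight p (edges_on T) (?F E) * of_bool (component_of (?F E) (f v) = T))"
    unfolding connected_weight_def by (rule sum.reindex_bij_betw[symmetric])
  also have "\<dots> = connected_weight p S v"
    unfolding connected_weight_def by (intro sum.cong) (auto simp: weight comp)
  finally show ?thesis by simp
qed

lemma connected_weight_card:
  assumes "finite S" "finite T" "card S = card T" "v \<in> S" "w \<in> T"
  shows "connected_weight p S v = connected_weight p T w"
proof -
  have "card (S - {v}) = card (T - {w})"
    using assms by simp
  then obtain h where h: "bij_betw h (S - {v}) (T - {w})"
    using assms finite_same_card_bij by (metis finite_Diff)
  have "bij_betw (h(v := w)) (S - {v}) (T - {w})"
    using h by (rule bij_betw_cong[THEN iffD1, rotated]) auto
  then have "bij_betw (h(v := w)) (S - {v} \<union> {v}) (T - {w} \<union> {w})"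
    by (rule bij_betw_combine) auto
  then have "bij_betw (h(v := w)) S T"
    using assms by (simp add: insert_absorb)
  from connected_weight_bij[OF this assms(4), of p] show ?thesis by simp
qed

lemma weight_component_eq:
  assumes "finite V" "v \<in> S" "S \<subseteq> V"
  shows "(\<Sum>E\<in>Pow (edges_on V). edge_weight p (edges_on V) E * of_bool (component_of E v = S)) =
    connected_weight p S v * (1 - p) ^ (card S * (card V - card S))"
proof -
  let ?I = "edges_on S" and ?B = "boundary_edges V S" and ?O = "edges_on (V - S)"
  have fin: "finite ?I" "finite ?B" "finite ?O" "finite (?B \<union> ?O)"
    using assms by (auto simp: boundary_edges_def intro!: finite_edges_on intro: finite_subset)
  have "?I \<inter> ?O = {}"
    by (auto elim!: edges_onE simp: doubleton_eq_iff)
  then have disj: "?I \<inter> (?B \<union> ?O) = {}" "?B \<inter> ?O = {}"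
    by (auto simp: boundary_edges_def)
  have V: "edges_on V = ?I \<union> (?B \<union> ?O)"
    using edges_on_mono[OF assms(3)] edges_on_mono[of "V - S" V]
    by (auto simp: boundary_edges_def)
  have "(\<Sum>E\<in>Pow (edges_on V). edge_weight p (edges_on V) E * of_bool (component_of E v = S)) =
      (\<Sum>E\<in>Pow (edges_on V). edge_weight p (edges_on V) E *
        (of_bool (component_of (E \<inter> ?I) v = S) * of_bool (E \<inter> (?B \<union> ?O) \<inter> ?B = {})))"
    by (intro sum.cong) (auto simp: component_of_eq_iff[OF _ assms(2,3)] Int_absorb1 Int_assoc)
  also have "\<dots> = connected_weight p S v *
      (\<Sum>E\<in>Pow (?B \<union> ?O). edge_weight p (?B \<union> ?O) E * of_bool (E \<inter> ?B = {}))"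
    unfolding V connected_weight_def
    by (rule sum_edge_weight_Un[OF fin(1,4) disj(1)])
  also have "(\<Sum>E\<in>Pow (?B \<union> ?O). edge_weight p (?B \<union> ?O) E * of_bool (E \<inter> ?B = {})) =
      (\<Sum>A\<in>Pow ?B. edge_weight p ?B A * of_bool (A = {}))"
    using sum_edge_weight_Un[OF fin(2,3) disj(2), of p "\<lambda>A. of_bool (A = {})" "\<lambda>_. 1"]
      sum_edge_weight_Pow[OF fin(3)] by simp
  also have "\<dots> = (\<Sum>A\<in>{{}}. edge_weight p ?B A)"
    using fin(2) by (intro sum.mono_neutral_cong_right) auto
  also have "\<dots> = (1 - p) ^ (card S * (card V - card S))"
    using assms by (simp add: edge_weight_def card_boundary_edges)
  finally show ?thesis .
qed

lemma card_subsets_containing: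
  assumes "finite V" "v \<in> V" "k \<ge> 1"
  shows "card {S. S \<subseteq> V \<and> v \<in> S \<and> card S = k} = (card V - 1) choose (k - 1)"
proof -
  have "bij_betw (insert v) {T. T \<subseteq> V - {v} \<and> card T = k - 1} {S. S \<subseteq> V \<and> v \<in> S \<and> card S = k}"
    by (rule bij_betwI[where g = "\<lambda>S. S - {v}"])
      (use assms in \<open>auto simp: card_insert_if subset_Diff_insert finite_subset intro: finite_subset\<close>)
  from bij_betw_same_card[OF this] show ?thesis
    using assms by (simp add: n_subsets)
qed

lemma sum_of_bool_component_size:
  assumes "finite V" "E \<subseteq> edges_on V" "v \<in> V"
  shows "(\<Sum>S | S \<subseteq> V \<and> v \<in> S \<and> card S = k. of_bool (component_of E v = S)) =
    (of_bool (card (component_of E v) = k) :: real)"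
proof -
  have "(\<Sum>S | S \<subseteq> V \<and> v \<in> S \<and> card S = k. of_bool (component_of E v = S)) =
      (\<Sum>S | S \<subseteq> V \<and> v \<in> S \<and> card S = k. if S = component_of E v then 1 else (0::real))"
    by (intro sum.cong) auto
  then show ?thesis
    using assms component_of_subset_vertices[OF assms(2,3)] component_of_self[of v E]
    by (simp add: sum.delta)
qed

lemma prob_component_size:
  assumes "0 \<le> p" "p \<le> 1" "m \<ge> 1" "k \<ge> 1"
  shows "measure_pmf.prob (erdos_renyi m p) {E. card (component_of E 1) = k} =
    real ((m - 1) choose (k - 1)) * connected_weight p {1..k} 1 * (1 - p) ^ (k * (m - k))"
proof -
  let ?V = "{1..m}" and ?\<S> = "{S. S \<subseteq> {1..m} \<and> 1 \<in> S \<and> card S = k}"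
  have "measure_pmf.prob (erdos_renyi m p) {E. card (component_of E 1) = k} =
      measure_pmf.expectation (erdos_renyi m p) (\<lambda>E. of_bool (card (component_of E 1) = k))"
    using Bochner_Integration.integral_indicator[of "measure_pmf (erdos_renyi m p)"
        "{E. card (component_of E 1) = k}"]
    by (simp add: indicator_def[abs_def])
  also have "\<dots> = (\<Sum>E\<in>Pow (edges_on ?V). edge_weight p (edges_on ?V) E *
      of_bool (card (component_of E 1) = k))"
    by (simp add: expectation_erdos_renyi assms vertex_pairs_eq)
  also have "\<dots> = (\<Sum>E\<in>Pow (edges_on ?V). \<Sum>S\<in>?\<S>. edge_weight p (edges_on ?V) E *
      of_bool (component_of E 1 = S))"
  proof (rule sum.cong)
    fix E assume "E \<in> Pow (edges_on ?V)"
    then show "edge_weight p (edges_on ?V) E * of_bool (card (component_of E 1) = k) =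
        (\<Sum>S\<in>?\<S>. edge_weight p (edges_on ?V) E * of_bool (component_of E 1 = S))"
      using assms sum_of_bool_component_size[of ?V E 1 k]
      unfolding sum_distrib_left[symmetric] by simp
  qed simp
  also have "\<dots> = (\<Sum>S\<in>?\<S>. \<Sum>E\<in>Pow (edges_on ?V). edge_weight p (edges_on ?V) E *
      of_bool (component_of E 1 = S))"
    by (rule sum.swap)
  also have "\<dots> = (\<Sum>S\<in>?\<S>. connected_weight p {1..k} 1 * (1 - p) ^ (k * (m - k)))"
  proof (rule sum.cong)
    fix S assume "S \<in> ?\<S>"
    then have S: "S \<subseteq> ?V" "1 \<in> S" "card S = k" by auto
    have "connected_weight p S 1 = connected_weight p {1..k} 1"
      using S assms by (intro connected_weight_card) (auto intro: finite_subset)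
    then show "(\<Sum>E\<in>Pow (edges_on ?V). edge_weight p (edges_on ?V) E *
        of_bool (component_of E 1 = S)) = connected_weight p {1..k} 1 * (1 - p) ^ (k * (m - k))"
      using S by (simp add: weight_component_eq)
  qed simp
  also have "\<dots> = real ((m - 1) choose (k - 1)) * connected_weight p {1..k} 1 *
      (1 - p) ^ (k * (m - k))"
    using assms by (simp add: card_subsets_containing)
  finally show ?thesis .
qed

lemma AE_component_size:
  assumes "m \<ge> 1"
  shows "AE E in measure_pmf (erdos_renyi m p). card (component_of E 1) \<in> {1..m}"
proof (rule AE_pmfI)
  fix E assume "E \<in> set_pmf (erdos_renyi m p)"
  then have "E \<subseteq> edges_on {1..m}"
    using set_pmf_erdos_renyi by (auto simp: vertex_pairs_eq)
  then have sub: "component_of E 1 \<subseteq> {1..m}"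
    using assms by (intro component_of_subset_vertices) auto
  then have "card (component_of E 1) \<le> m"
    using card_mono[OF _ sub] by simp
  moreover have "card (component_of E 1) > 0"
    using sub component_of_self[of 1 E] by (auto simp: card_gt_0_iff intro: finite_subset)
  ultimately show "card (component_of E 1) \<in> {1..m}" by simp
qed

lemma expectation_component_size:
  fixes f :: "nat \<Rightarrow> real"
  assumes "m \<ge> 1"
  shows "measure_pmf.expectation (erdos_renyi m p) (\<lambda>E. f (card (component_of E 1))) =
    (\<Sum>k=1..m. f k * measure_pmf.prob (erdos_renyi m p) {E. card (component_of E 1) = k})"
proof -
  let ?M = "map_pmf (\<lambda>E. card (component_of E 1)) (erdos_renyi m p)"
  have "measure_pmf.expectation ?M f = (\<Sum>k=1..m. f k * pmf ?M k)"
    using AE_component_size[OF assms, of p]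
    by (intro integral_measure_pmf_real) (auto simp: AE_measure_pmf_iff)
  then show ?thesis
    by (simp add: pmf_map vimage_def)
qed

lemma prob_component_size_gt:
  assumes "m \<ge> 1"
  shows "1 - measure_pmf.prob (erdos_renyi m p) {E. card (component_of E 1) > n} =
    (\<Sum>k=1..n. measure_pmf.prob (erdos_renyi m p) {E. card (component_of E 1) = k})"
proof -
  let ?P = "measure_pmf.prob (erdos_renyi m p)"
  have "1 - ?P {E. card (component_of E 1) > n} = ?P {E. card (component_of E 1) \<le> n}"
    using measure_pmf.prob_compl[of "{E. card (component_of E 1) > n}" "erdos_renyi m p"]
    by (simp add: Compl_eq_Diff_UNIV[symmetric] Collect_neg_eq[symmetric] not_less)
  also have "\<dots> = ?P (\<Union>k\<in>{1..n}. {E. card (component_of E 1) = k})"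
    using AE_component_size[OF assms, of p]
    by (intro measure_pmf.finite_measure_eq_AE) (auto simp: AE_measure_pmf_iff)
  also have "\<dots> = (\<Sum>k=1..n. ?P {E. card (component_of E 1) = k})"
    by (intro measure_pmf.finite_measure_finite_Union) (auto simp: disjoint_family_on_def)
  finally show ?thesis .
qed

subsection \<open>Comparison of two graph sizes\<close>

lemma prod_ratio_choose:
  assumes "1 \<le> k" "k \<le> n" "m \<ge> 1"
  shows "(\<Prod>i<k. (real m - real i) / (real n - real i)) * real ((n - 1) choose (k - 1)) =
    real m / real n * real ((m - 1) choose (k - 1))"
proof -
  have falling: "(\<Prod>i<k. real a - real i) = fact k * real (a choose k)" for a
    by (simp add: binomial_gbinomial gbinomial_prod_rev atLeast0LessThan)
  have absorb: "real k * real (a choose k) = real a * real ((a - 1) choose (k - 1))" if "a \<ge> 1" for a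
    using that assms(1) times_binomial_minus1_eq[of k a] by (simp flip: of_nat_mult)
  have pos: "real (n choose k) > 0" "real k > 0" "real n > 0"
    using assms by auto
  have "(\<Prod>i<k. (real m - real i) / (real n - real i)) = real (m choose k) / real (n choose k)"
    by (simp add: prod_dividef falling)
  also have "\<dots> = (real k * real (m choose k)) / (real k * real (n choose k))"
    using pos by simp
  also have "\<dots> = (real m * real ((m - 1) choose (k - 1))) / (real n * real ((n - 1) choose (k - 1)))"
    using assms by (simp add: absorb)
  finally show ?thesis
    using assms by (simp add: field_simps)
qed

lemma g_mult_prob:
  assumes "0 \<le> p" "p \<le> 1" "1 \<le> k" "k \<le> n" "m \<ge> 1" "int m = int n + j" "p = 1 \<Longrightarrow> j \<ge> 0"
  shows "g n p j k * measure_pmf.prob (erdos_renyi n p) {E. card (component_of E 1) = k} =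
    real m / real n * measure_pmf.prob (erdos_renyi m p) {E. card (component_of E 1) = k}"
proof -
  let ?c = "connected_weight p {1..k} 1"
  have m: "real m = real n + real_of_int j"
    using arg_cong[OF assms(6), of real_of_int] by simp
  have n_pos: "n \<ge> 1" using assms by simp
  have prod: "(\<Prod>i<k. (real n - real i + real_of_int j) / (real n - real i)) *
      real ((n - 1) choose (k - 1)) = real m / real n * real ((m - 1) choose (k - 1))"
    using prod_ratio_choose[OF assms(3-5)] by (simp add: m algebra_simps)
  have "g n p j k * measure_pmf.prob (erdos_renyi n p) {E. card (component_of E 1) = k} =
      (real m / real n * real ((m - 1) choose (k - 1))) * ?c *
      ((1 - p) powi (j * int k) * (1 - p) ^ (k * (n - k)))"
    unfolding prob_component_size[OF assms(1,2) n_pos assms(3)] g_def prod[symmetric] by simp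
  also have "\<dots> = (real m / real n * real ((m - 1) choose (k - 1))) * ?c * (1 - p) ^ (k * (m - k))"
  proof (cases "k \<le> m")
    case True
    have e: "j * int k + int (k * (n - k)) = int (k * (m - k))"
      using True assms by (simp add: of_nat_diff algebra_simps)
    have "(1 - p) powi (j * int k) * (1 - p) powi int (k * (n - k)) = (1 - p) powi int (k * (m - k))"
    proof (cases "p = 1")
      case False
      then show ?thesis
        by (subst power_int_add[symmetric]) (auto simp only: e)
    next
      case True
      then have "j \<ge> 0" using assms by simp
      then obtain i where "j = int i" by (metis nonneg_int_cases)
      then show ?thesis
        using e by (simp flip: power_add of_nat_mult of_nat_add)
    qed
    then show ?thesis by (simp only: power_int_of_nat)
  qed (use assms in \<open>simp add: binomial_eq_0\<close>)
  also have "\<dots> = real m / real n * measure_pmf.prob (erdos_renyi m p) {E. card (component_of E 1) = k}"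
    unfolding prob_component_size[OF assms(1,2,5,3)] by simp
  finally show ?thesis .
qed

theorem proposition1p1:
  fixes n :: nat and j :: int and p :: real
  assumes "n \<ge> 1" and "j > - int n" and "0 \<le> p" and "p \<le> 1"
    and g_well_defined: "p = 1 \<Longrightarrow> j \<ge> 0"
  shows "measure_pmf.expectation (erdos_renyi n p) (\<lambda>E. g n p j (card (component_of E 1))) =
    (real n + real_of_int j) / real n *
    (1 - measure_pmf.prob (erdos_renyi (nat (int n + j)) p) {E. card (component_of E 1) > n})"
proof -
  define m where "m = nat (int n + j)"
  have m: "int m = int n + j" "m \<ge> 1"
    using assms by (auto simp: m_def)
  then have m_real: "real m = real n + real_of_int j"
    using arg_cong[OF m(1), of real_of_int] by simp
  have "measure_pmf.expectation (erdos_renyi n p) (\<lambda>E. g n p j (card (component_of E 1))) =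
      (\<Sum>k=1..n. g n p j k * measure_pmf.prob (erdos_renyi n p) {E. card (component_of E 1) = k})"
    using assms by (intro expectation_component_size)
  also have "\<dots> = (\<Sum>k=1..n. real m / real n *
      measure_pmf.prob (erdos_renyi m p) {E. card (component_of E 1) = k})"
    using assms m by (intro sum.cong refl g_mult_prob) auto
  also have "\<dots> = real m / real n *
      (1 - measure_pmf.prob (erdos_renyi m p) {E. card (component_of E 1) > n})"
    by (simp only: prob_component_size_gt[OF m(2)] sum_distrib_left)
  finally show ?thesis
    unfolding m_real unfolding m_def .
qed

end
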